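(* Let $d,n\in\mathbb N$ with $n\geqslant 16d$, and let $p=\binom{n}{d}$. Let $\mathbf x_p$ be a random vector in $\mathbb R^p$ following the random tensor model with parameters $d,n$, built from independent zero-mean unit-variance random variables $X_1,\ldots,X_n$, let $A_p\in\mathbb R^{p\times p}$ be a (nonrandom) matrix, and set $K_n=\max\{\mathbb E X_\alpha^4:1\leqslant\alpha\leqslant n\}$. Then \[ \mathrm{Var}(\mathbf x_p^\top A_p\mathbf x_p)\leqslant p\,\mathrm{tr}(A_pA_p^\top)\cdot \begin{cases} (1+K_nd/n)^d-1 &\text{if }A_p\text{ is diagonal},\\ (1+2K_nd/n)^d\,(16d/n)\,(d\wedge 8) &\text{if }A_p\text{ is zero-diagonal},\\ 64K_nd^2/n &\text{if }A_p\text{ is arbitrary and }2K_nd^2\leqslant n. \end{cases} \]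
   Context: Random tensor model: a random vector $\mathbf x_p$ in $\mathbb R^p$ follows the random tensor model with parameters $d,n\in\mathbb N$, $d\leqslant n$, if $p=\binom{n}{d}$ and there exist independent real random variables $X_1,\ldots,X_n$ with zero mean and unit variance such that the entries of $\mathbf x_p$ can be indexed by the $d$-element subsets $i\subseteq\{1,\ldots,n\}$ and the entry with index $i$ equals $\prod_{\alpha\in i}X_\alpha$. The rows and columns of $A_p$ are indexed in the same way. "Zero-diagonal" means that all diagonal entries of $A_p$ are $0$. $d\wedge 8=\min\{d,8\}$. Expectations of nonnegative random variables (e.g. $\mathbb E X_\alpha^4$) are understood as elements of $[0,\infty]$, with $0\cdot\infty=0$. *)

theory Defs
  imports "HOL-Probability.Probability"
begin

text \<open>
  The finite type \<open>'p\<close> plays the role of the coordinate set \<open>{1,\<dots>,p}\<close>; the bijection \<open>e\<close> is the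
  indexing of the coordinates by the \<open>d\<close>-element subsets of \<open>{1,\<dots>,n}\<close>.  The rows and columns of a
  matrix of type \<open>real ^ 'p ^ 'p\<close> are then indexed by the same \<open>e\<close>.
\<close>

definition (in prob_space) random_tensor_model ::
  "nat \<Rightarrow> nat \<Rightarrow> (nat \<Rightarrow> 'a \<Rightarrow> real) \<Rightarrow> ('a \<Rightarrow> real ^ 'p) \<Rightarrow> bool" where
  "random_tensor_model d n X x \<longleftrightarrow>
     d \<le> n \<and> CARD('p) = n choose d \<and>
     indep_vars (\<lambda>_. borel) X {1..n} \<and>
     (\<forall>\<alpha>\<in>{1..n}. integrable M (X \<alpha>) \<and> expectation (X \<alpha>) = 0 \<and> variance (X \<alpha>) = 1) \<and>
     (\<exists>e. bij_betw e (UNIV :: 'p set) {i. i \<subseteq> {1..n} \<and> card i = d} \<and>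
          (\<forall>\<omega>\<in>space M. \<forall>k. x \<omega> $ k = (\<Prod>\<alpha>\<in>e k. X \<alpha> \<omega>)))"

text \<open>
  The variance as an element of \<open>[0,\<infinity>]\<close>.  The library's \<open>variance\<close> is a Bochner integral, hence
  \<open>0\<close> for integrable variables that are not square-integrable.
\<close>

definition (in prob_space) ennvariance :: "('a \<Rightarrow> real) \<Rightarrow> ennreal" where
  "ennvariance Y = (\<integral>\<^sup>+ \<omega>. ennreal ((Y \<omega> - expectation Y)\<^sup>2) \<partial>M)"

end

theory Submission
  imports Defs
begin

text \<open>
  Split the centred quadratic form into \<open>\<Sum>\<^sub>i A\<^sub>i\<^sub>i (x\<^sub>i\<^sup>2 - 1)\<close> and the off-diagonal part.  The second moment of
  either part is a quadratic form in the entries of \<open>A\<close>, with a kernel bounded entrywise by products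
  of moments of the \<open>X\<^sub>\<alpha>\<close>, and the Schur test applies.  With \<open>r = d/n\<close>, at most \<open>p r\<^sup>m\<close> of the
  \<open>d\<close>-element sets contain a given \<open>m\<close>-element set, so the row sums are dominated by products over
  the indices \<open>\<alpha>\<close>.  For the off-diagonal part the unweighted Schur test is too weak: an
  index pair \<open>(i, j)\<close> gets the weight \<open>\<nu>\<close> to the power \<open>|i \<triangle> j|\<close> with \<open>\<nu> = \<surd>(K r) / 2\<close>.  Each
  \<open>\<alpha> \<in> i \<triangle> j\<close> then contributes the factor \<open>4 \<surd>r\<close> and each \<open>\<alpha> \<in> i \<inter> j\<close> the factor \<open>1 + 2 K r\<close>;
  since \<open>|i \<triangle> j| \<ge> 2\<close> and \<open>16 r \<le> 1\<close>, the row sums are at most \<open>16 r (1 + 2 K r)\<^sup>d p\<close>, even without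
  the factor \<open>d \<and> 8\<close>.  For arbitrary \<open>A\<close> the two bounds are combined by \<open>(y + z)\<^sup>2 \<le> 4 y\<^sup>2 + 4/3 z\<^sup>2\<close>,
  where \<open>4/3\<close> is the largest constant allowed by \<open>16 e \<le> 48\<close> and the target \<open>64\<close>.
\<close>

section \<open>Counting the sets of fixed size that contain a given set\<close>

text \<open>Passing from \<open>m\<close> to \<open>m + 1\<close> multiplies the binomial
  coefficient by (d - m) / (n - m), and this ratio is at most d / n because
  \<open>d \<le> n\<close>.\<close>

lemma binomial_diff_le:
  assumes "m \<le> d" "d \<le> n"
  shows "real ((n - m) choose (d - m)) \<le> real (n choose d) * (real d / real n) ^ m"
  using assms(1)
proof (induction m)
  case 0
  then show ?case by simp
next
  case (Suc m)
  define n' d' where "n' = n - Suc m" and "d' = d - Suc m"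
  have n: "n - m = Suc n'" "d - m = Suc d'"
    using Suc.prems assms(2) by (auto simp: n'_def d'_def)
  have "Suc n' * (n' choose d') = (Suc n' choose Suc d') * Suc d'"
    by (rule Suc_times_binomial_eq)
  then have "real (Suc n') * real (n' choose d') = real (Suc n' choose Suc d') * real (Suc d')"
    by (metis of_nat_mult)
  then have *: "real (n' choose d') = real (Suc n' choose Suc d') * (real (Suc d') / real (Suc n'))"
    by (simp add: field_simps)
  have "real (Suc d') / real (Suc n') = (real d - real m) / (real n - real m)"
    using n Suc.prems assms(2) by (metis Suc_leD le_trans of_nat_diff)
  also have "\<dots> \<le> real d / real n"
    using Suc.prems assms(2) mult_left_mono[of "real d" "real n" "real m"]
    by (simp add: divide_simps algebra_simps)
  finally have "real (n' choose d') \<le> real (Suc n' choose Suc d') * (real d / real n)"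
    unfolding * by (intro mult_left_mono) auto
  also have "\<dots> \<le> real (n choose d) * (real d / real n) ^ m * (real d / real n)"
    using Suc n by (intro mult_right_mono) auto
  finally show ?case
    by (simp add: n'_def d'_def mult_ac)
qed

text \<open>Removing \<open>m\<close> is a bijection onto the sets of size \<open>d - card m\<close>
  in \<open>N - m\<close>, which are counted by a binomial coefficient. If \<open>card m\<close>
  exceeds \<open>d\<close>, there is nothing to count; this case is separate because natural
  subtraction would truncate.\<close>

lemma card_supersets_le:
  assumes "finite N" "m \<subseteq> N" "d \<le> card N"
  shows "real (card {k. k \<subseteq> N \<and> card k = d \<and> m \<subseteq> k}) \<le>
    real (card N choose d) * (real d / real (card N)) ^ card m"
proof (cases "card m \<le> d")
  case False
  have "{k. k \<subseteq> N \<and> card k = d \<and> m \<subseteq> k} = {}"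
    using False card_mono[of _ m] rev_finite_subset[OF assms(1)] by auto
  then show ?thesis by (simp only: card.empty) simp
next
  case True
  have fin: "finite k" if "k \<subseteq> N" for k
    using assms(1) that by (rule rev_finite_subset)
  have "bij_betw (\<lambda>k. k - m) {k. k \<subseteq> N \<and> card k = d \<and> m \<subseteq> k}
      {k. k \<subseteq> N - m \<and> card k = d - card m}"
    by (rule bij_betw_byWitness[where f' = "\<lambda>k. k \<union> m"])
       (use assms fin True in \<open>auto simp: card_Diff_subset card_Un_disjoint Diff_disjoint
          subset_iff disjoint_iff intro!: card_Un_disjoint[THEN trans]\<close>)
  then have "card {k. k \<subseteq> N \<and> card k = d \<and> m \<subseteq> k} = (card N - card m) choose (d - card m)"
    using assms fin by (simp add: bij_betw_same_card n_subsets card_Diff_subset)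
  then show ?thesis
    using binomial_diff_le[OF True assms(3)] by simp
qed

section \<open>Sums of products over the subsets of a finite set\<close>

text \<open>Multiplying out the product on the right means choosing one of two summands for each
  \<alpha>; the set of places where the first is chosen is \<open>k\<close>. This turns sums over
  sets into products of contributions of single indices.\<close>

lemma sum_Pow_prod:
  fixes h :: "'i \<Rightarrow> bool \<Rightarrow> 'b :: comm_semiring_1"
  assumes "finite U"
  shows "(\<Sum>k\<in>Pow U. \<Prod>\<alpha>\<in>U. h \<alpha> (\<alpha> \<in> k)) = (\<Prod>\<alpha>\<in>U. h \<alpha> True + h \<alpha> False)"
proof -
  have "(\<Prod>\<alpha>\<in>U. h \<alpha> (\<alpha> \<in> k)) = (\<Prod>\<alpha>\<in>k. h \<alpha> True) * (\<Prod>\<alpha>\<in>U - k. h \<alpha> False)" if "k \<subseteq> U" for k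
  proof -
    have "(\<Prod>\<alpha>\<in>U. h \<alpha> (\<alpha> \<in> k)) = (\<Prod>\<alpha>\<in>U - k. h \<alpha> (\<alpha> \<in> k)) * (\<Prod>\<alpha>\<in>k. h \<alpha> (\<alpha> \<in> k))"
      using assms that by (rule prod.subset_diff[rotated])
    then show ?thesis by (simp add: mult.commute)
  qed
  then show ?thesis
    by (subst prod_add[OF assms]) auto
qed

lemma sum_Pow_Pow_prod:
  fixes h :: "'i \<Rightarrow> bool \<Rightarrow> bool \<Rightarrow> 'b :: comm_semiring_1"
  assumes "finite U"
  shows "(\<Sum>k\<in>Pow U. \<Sum>l\<in>Pow U. \<Prod>\<alpha>\<in>U. h \<alpha> (\<alpha> \<in> k) (\<alpha> \<in> l)) =
    (\<Prod>\<alpha>\<in>U. (h \<alpha> True True + h \<alpha> True False) + (h \<alpha> False True + h \<alpha> False False))"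
  using sum_Pow_prod[OF assms, of "\<lambda>\<alpha> a. h \<alpha> a True + h \<alpha> a False"]
  by (simp add: sum_Pow_prod[OF assms, of "\<lambda>\<alpha>. h \<alpha> (\<alpha> \<in> _)"])

section \<open>Weighted Schur test and row sums of the moment kernels\<close>

text \<open>The inequality of arithmetic and geometric means, with the ratio
  \<open>w t / w s\<close> as weight, splits each product of entries of \<open>u\<close> into two
  squares. By symmetry of \<open>g\<close> the two resulting double sums agree, and each is a sum
  over rows to which the row bound applies.\<close>

lemma weighted_Schur_test:
  fixes u w :: "'b \<Rightarrow> real" and g :: "'b \<Rightarrow> 'b \<Rightarrow> real"
  assumes "\<And>s. s \<in> P \<Longrightarrow> 0 < w s"
    and "\<And>s t. s \<in> P \<Longrightarrow> t \<in> P \<Longrightarrow> 0 \<le> g s t"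
    and sym: "\<And>s t. s \<in> P \<Longrightarrow> t \<in> P \<Longrightarrow> g s t = g t s"
    and row: "\<And>s. s \<in> P \<Longrightarrow> (\<Sum>t\<in>P. g s t * w t) \<le> B * w s"
  shows "(\<Sum>s\<in>P. \<Sum>t\<in>P. \<bar>u s\<bar> * \<bar>u t\<bar> * g s t) \<le> B * (\<Sum>s\<in>P. (u s)\<^sup>2)"
proof -
  let ?f = "\<lambda>s t. (u s)\<^sup>2 / w s * (g s t * w t)"
  have *: "\<bar>u s\<bar> * \<bar>u t\<bar> * g s t \<le> (?f s t + ?f t s) / 2" if st: "s \<in> P" "t \<in> P" for s t
  proof -
    have w: "0 < w s" "0 < w t" using assms(1) st by auto
    have "0 \<le> (\<bar>u s\<bar> * w t - \<bar>u t\<bar> * w s)\<^sup>2 / (w s * w t)"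
      using w by simp
    also have "\<dots> = (u s)\<^sup>2 * w t / w s + (u t)\<^sup>2 * w s / w t - 2 * (\<bar>u s\<bar> * \<bar>u t\<bar>)"
      using w by (simp add: power2_diff power_mult_distrib divide_simps)
                 (simp add: power2_eq_square algebra_simps)
    finally have "\<bar>u s\<bar> * \<bar>u t\<bar> \<le> ((u s)\<^sup>2 * w t / w s + (u t)\<^sup>2 * w s / w t) / 2" by simp
    then have "\<bar>u s\<bar> * \<bar>u t\<bar> * g s t \<le> ((u s)\<^sup>2 * w t / w s + (u t)\<^sup>2 * w s / w t) / 2 * g s t"
      using assms(2) st by (intro mult_right_mono)
    also have "\<dots> = (?f s t + ?f t s) / 2"
      using sym[OF st] by (simp add: field_simps)
    finally show ?thesis .
  qed
  have "(\<Sum>s\<in>P. \<Sum>t\<in>P. \<bar>u s\<bar> * \<bar>u t\<bar> * g s t) \<le> (\<Sum>s\<in>P. \<Sum>t\<in>P. (?f s t + ?f t s) / 2)"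
    by (intro sum_mono *)
  also have "\<dots> = ((\<Sum>s\<in>P. \<Sum>t\<in>P. ?f s t) + (\<Sum>s\<in>P. \<Sum>t\<in>P. ?f t s)) / 2"
    by (simp only: sum.distrib sum_divide_distrib[symmetric])
  also have "(\<Sum>s\<in>P. \<Sum>t\<in>P. ?f t s) = (\<Sum>s\<in>P. \<Sum>t\<in>P. ?f s t)"
    by (rule sum.swap)
  also have "((\<Sum>s\<in>P. \<Sum>t\<in>P. ?f s t) + (\<Sum>s\<in>P. \<Sum>t\<in>P. ?f s t)) / 2 =
      (\<Sum>s\<in>P. (u s)\<^sup>2 / w s * (\<Sum>t\<in>P. g s t * w t))"
    unfolding sum_distrib_left by (rule field_sum_of_halves[folded add_divide_distrib])
  also have "\<dots> \<le> (\<Sum>s\<in>P. (u s)\<^sup>2 / w s * (B * w s))"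
    using assms(1) by (intro sum_mono mult_left_mono row) (auto intro!: divide_nonneg_pos)
  also have "\<dots> = B * (\<Sum>s\<in>P. (u s)\<^sup>2)"
    unfolding sum_distrib_left using assms(1) by (intro sum.cong refl) (simp add: less_imp_neq[symmetric])
  finally show ?thesis .
qed

text \<open>The junk value 1 for multiplicities above 4 is never used.\<close>

definition moment_bound :: "real \<Rightarrow> nat \<Rightarrow> real" where
  "moment_bound K c = (if c = 1 then 0 else if c = 3 then sqrt K else if c = 4 then K else 1)"

text \<open>This is the exponent of \<open>X \<alpha>\<close> in the product of the four monomials
  over \<open>i\<close>, \<open>j\<close>, \<open>k\<close> and \<open>l\<close>.\<close>

definition multiplicity4 :: "'i set \<Rightarrow> 'i set \<Rightarrow> 'i set \<Rightarrow> 'i set \<Rightarrow> 'i \<Rightarrow> nat" where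
  "multiplicity4 i j k l \<alpha> = of_bool (\<alpha> \<in> i) + of_bool (\<alpha> \<in> j) + of_bool (\<alpha> \<in> k) + of_bool (\<alpha> \<in> l)"

lemma moment_bound_nonneg: "0 \<le> K \<Longrightarrow> 0 \<le> moment_bound K c"
  by (simp add: moment_bound_def)

text \<open>Spreading a power over the ground set allows it to be merged, index by index, with the
  products of moment bounds.\<close>

lemma power_card_eq_prod:
  fixes z :: "'b :: comm_monoid_mult"
  assumes "finite N" "k \<subseteq> N"
  shows "z ^ card k = (\<Prod>\<alpha>\<in>N. z ^ of_bool (\<alpha> \<in> k))"
proof -
  have "(\<Prod>\<alpha>\<in>N. z ^ of_bool (\<alpha> \<in> k)) = (\<Prod>\<alpha>\<in>k. z ^ of_bool (\<alpha> \<in> k))"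
    using assms by (intro prod.mono_neutral_right) auto
  then show ?thesis by simp
qed

text \<open>The kernel vanishes unless \<open>k\<close> and \<open>l\<close> agree outside
  \<open>i \<union> j\<close>, so the pairs are grouped by their traces on this union. The size of
  each group is bounded by an expression that factors over the indices, and so does the kernel; the
  sum over all traces is then a product of four-term sums, one for each index.\<close>

lemma weighted_row_sum_le:
  fixes K :: real and N i j :: "'i set" and d :: nat
  defines "r \<equiv> real d / real (card N)"
  defines "\<nu> \<equiv> sqrt (K * r) / 2"
  defines "S \<equiv> {k. k \<subseteq> N \<and> card k = d}"
  assumes N: "finite N" "d \<le> card N" and ij: "i \<in> S" "j \<in> S" and K: "0 < K"
  shows "(\<Sum>k\<in>S. \<Sum>l\<in>S. (\<Prod>\<alpha>\<in>N. moment_bound K (multiplicity4 i j k l \<alpha>)) * \<nu> ^ card (sym_diff k l))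
    \<le> real (card N choose d) * ((4 * sqrt r * \<nu>) ^ card (sym_diff i j) * (1 + 2 * K * r) ^ card (i \<inter> j))"
proof -
  define U where "U = i \<union> j"
  have r: "0 \<le> r" by (simp add: r_def)
  have lam: "0 \<le> \<nu>" using r K by (simp add: \<nu>_def)
  have U: "U \<subseteq> N" "finite U" using ij N by (auto simp: U_def S_def intro: finite_subset)
  have finS: "finite S" using N by (simp add: S_def)
  have fin: "finite k" if "k \<subseteq> N" for k
    using N(1) that by (rule rev_finite_subset)
  define T where "T k l = (\<Prod>\<alpha>\<in>N. moment_bound K (multiplicity4 i j k l \<alpha>)) * \<nu> ^ card (sym_diff k l)" for k l
  \<comment> \<open>The contribution of a single index: \<open>a\<close> and \<open>b\<close> stand
    for membership in \<open>k\<close> and \<open>l\<close>, and the power of \<nu> records whether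
    the index lies in \<open>sym_diff k l\<close>.\<close>
  define f where "f \<alpha> a b = moment_bound K (of_bool (\<alpha> \<in> i) + of_bool (\<alpha> \<in> j) + of_bool a + of_bool b)
      * \<nu> ^ of_bool (a \<noteq> b)" for \<alpha> and a b :: bool
  define F where "F k l = (\<Prod>\<alpha>\<in>U. f \<alpha> (\<alpha> \<in> k) (\<alpha> \<in> l))" for k l
  have f_nonneg: "0 \<le> f \<alpha> a b" for \<alpha> a b
    using lam K by (simp add: f_def moment_bound_nonneg)
  have F_nonneg: "0 \<le> F k l" for k l
    by (simp add: F_def prod_nonneg f_nonneg)
  have T_prod: "T k l = (\<Prod>\<alpha>\<in>N. f \<alpha> (\<alpha> \<in> k) (\<alpha> \<in> l))" if "k \<in> S" "l \<in> S" for k l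
  proof -
    have "sym_diff k l \<subseteq> N" using that by (auto simp: S_def)
    moreover have "(\<alpha> \<in> sym_diff k l) = ((\<alpha> \<in> k) \<noteq> (\<alpha> \<in> l))" for \<alpha> by auto
    ultimately show ?thesis
      using power_card_eq_prod[OF N(1), of "sym_diff k l" \<nu>]
      by (simp add: T_def f_def multiplicity4_def prod.distrib)
  qed
  \<comment> \<open>An index outside \<open>U\<close> lying in only one of \<open>k\<close>, \<open>l\<close> would have multiplicity 1.\<close>
  have T_zero: "T k l = 0" if "k \<in> S" "l \<in> S" and ne: "k - U \<noteq> l - U" for k l
  proof -
    obtain \<alpha> where a: "\<alpha> \<notin> U" "(\<alpha> \<in> k) \<noteq> (\<alpha> \<in> l)" using ne by blast
    then have "f \<alpha> (\<alpha> \<in> k) (\<alpha> \<in> l) = 0"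
      by (auto simp: f_def U_def moment_bound_def)
    moreover have "\<alpha> \<in> N" using a that by (auto simp: S_def)
    ultimately show ?thesis
      using N(1) T_prod[OF that(1,2)] by (auto intro: prod_zero)
  qed
  have T_eq: "T k l = F (k \<inter> U) (l \<inter> U)" if "k \<in> S" "l \<in> S" "k - U = l - U" for k l
  proof -
    \<comment> \<open>Such an index lies in both or neither of \<open>k\<close> and
      \<open>l\<close>, so its multiplicity is 2 or 0, and both moments are 1.\<close>
    have "f \<alpha> (\<alpha> \<in> k) (\<alpha> \<in> l) = 1" if "\<alpha> \<in> N - U" for \<alpha>
    proof -
      have "(\<alpha> \<in> k) = (\<alpha> \<in> l)" using that \<open>k - U = l - U\<close> by blast
      then show ?thesis using that by (auto simp: f_def U_def moment_bound_def)
    qed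
    then have "T k l = (\<Prod>\<alpha>\<in>U. f \<alpha> (\<alpha> \<in> k) (\<alpha> \<in> l))"
      using N(1) U(1) T_prod[OF that(1,2)] by (simp add: prod.mono_neutral_right)
    then show ?thesis by (simp add: F_def)
  qed
  define p where "p = real (card N choose d)"
  define C where "C k' l' = {(k, l). k \<in> S \<and> l \<in> S \<and> k \<inter> U = k' \<and> l \<inter> U = l' \<and> k - U = l - U}" for k' l'
  have C_card: "real (card (C k' l')) \<le> p * (sqrt r ^ card k' * sqrt r ^ card l')"
    if "k' \<subseteq> U" "l' \<subseteq> U" for k' l'
  proof (cases "C k' l' = {}")
    case True
    then show ?thesis using r by (simp add: p_def)
  next
    case False
    then obtain k l where kl: "k \<in> S" "l \<in> S" "k \<inter> U = k'" "l \<inter> U = l'" "k - U = l - U"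
      by (auto simp: C_def)
    have "card k = card k' + card (k - U)" "card l = card l' + card (l - U)"
      using card_Int_Diff[of k U] card_Int_Diff[of l U] kl fin by (auto simp: S_def)
    \<comment> \<open>Equal sizes permit \<open>r ^ card k'\<close> to be split evenly between the
      two traces. An index in only one of them then costs \<open>sqrt r\<close> whichever trace it
      is, instead of \<open>r\<close> in one case and 1 in the other.\<close>
    then have eq: "card k' = card l'" using kl by (simp add: S_def)
    \<comment> \<open>The first component determines the second, namely as the union of
      \<open>k - U\<close> and \<open>l'\<close>.\<close>
    have "inj_on fst (C k' l')"
      by (auto simp: inj_on_def C_def)
    moreover have "fst ` C k' l' \<subseteq> {k. k \<subseteq> N \<and> card k = d \<and> k' \<subseteq> k}"
      by (auto simp: C_def S_def)
    ultimately have "card (C k' l') \<le> card {k. k \<subseteq> N \<and> card k = d \<and> k' \<subseteq> k}"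
      using N(1) by (intro card_inj_on_le) auto
    also have "real (\<dots>) \<le> p * r ^ card k'"
      unfolding p_def r_def using N that U by (intro card_supersets_le) auto
    finally show ?thesis
      using r by (simp add: eq power_mult_distrib[symmetric])
  qed
  have "(\<Sum>k\<in>S. \<Sum>l\<in>S. T k l) = (\<Sum>(k, l)\<in>S \<times> S. T k l)"
    by (simp add: sum.cartesian_product)
  also have "\<dots> = (\<Sum>(k, l)\<in>{(k, l)\<in>S \<times> S. k - U = l - U}. F (k \<inter> U) (l \<inter> U))"
    using finS T_zero T_eq by (intro sum.mono_neutral_cong_right) auto
  also have "\<dots> = (\<Sum>(k', l')\<in>Pow U \<times> Pow U. \<Sum>(k, l)\<in>C k' l'. F (k \<inter> U) (l \<inter> U))"
  proof -
    let ?Q = "{(k, l)\<in>S \<times> S. k - U = l - U}" and ?h = "\<lambda>x. (fst x \<inter> U, snd x \<inter> U)"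
    have Q: "{x \<in> ?Q. ?h x = y} = C (fst y) (snd y)" for y
    proof (rule set_eqI)
      fix x show "x \<in> {x \<in> ?Q. ?h x = y} \<longleftrightarrow> x \<in> C (fst y) (snd y)"
        by (cases x; cases y; simp only: C_def mem_Collect_eq mem_Sigma_iff case_prod_conv fst_conv snd_conv prod.inject; argo)
    qed
    have "(\<Sum>y\<in>Pow U \<times> Pow U. \<Sum>x\<in>{x \<in> ?Q. ?h x = y}. (\<lambda>(k, l). F (k \<inter> U) (l \<inter> U)) x) =
        (\<Sum>x\<in>?Q. (\<lambda>(k, l). F (k \<inter> U) (l \<inter> U)) x)"
      using U finS by (intro sum.group) (auto intro: finite_subset[of _ "S \<times> S"])
    then show ?thesis
      unfolding Q by (simp only: case_prod_unfold)
  qed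
  also have "\<dots> = (\<Sum>(k', l')\<in>Pow U \<times> Pow U. real (card (C k' l')) * F k' l')"
  proof (intro sum.cong refl, clarify)
    fix k' l'
    have "(\<Sum>(k, l)\<in>C k' l'. F (k \<inter> U) (l \<inter> U)) = (\<Sum>(k, l)\<in>C k' l'. F k' l')"
      by (intro sum.cong) (auto simp: C_def)
    then show "(\<Sum>(k, l)\<in>C k' l'. F (k \<inter> U) (l \<inter> U)) = real (card (C k' l')) * F k' l'"
      by simp
  qed
  also have "\<dots> \<le> (\<Sum>(k', l')\<in>Pow U \<times> Pow U. p * (sqrt r ^ card k' * sqrt r ^ card l') * F k' l')"
    using C_card F_nonneg by (intro sum_mono) (auto intro!: mult_right_mono)
  also have "\<dots> = p * (\<Sum>k'\<in>Pow U. \<Sum>l'\<in>Pow U. sqrt r ^ card k' * sqrt r ^ card l' * F k' l')"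
    by (simp only: sum.cartesian_product[symmetric] sum_distrib_left mult.assoc)
  also have "(\<Sum>k'\<in>Pow U. \<Sum>l'\<in>Pow U. sqrt r ^ card k' * sqrt r ^ card l' * F k' l') =
      (\<Sum>k'\<in>Pow U. \<Sum>l'\<in>Pow U. \<Prod>\<alpha>\<in>U.
        sqrt r ^ of_bool (\<alpha> \<in> k') * sqrt r ^ of_bool (\<alpha> \<in> l') * f \<alpha> (\<alpha> \<in> k') (\<alpha> \<in> l'))"
    by (intro sum.cong refl) (simp add: F_def power_card_eq_prod[OF U(2)] prod.distrib)
  \<comment> \<open>The choice of \<nu> is made here. For an index in \<open>sym_diff i j\<close>
    the four terms are \<open>r * sqrt K\<close>, twice \<open>sqrt r * \<nu>\<close>, and 0; the
    first equals \<open>2 * sqrt r * \<nu>\<close>. For an index in \<open>i \<inter> j\<close> they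
    are \<open>K * r\<close>, twice \<open>sqrt r * sqrt K * \<nu> = K * r / 2\<close>, and
    1.\<close>
  also have "\<dots> = (\<Prod>\<alpha>\<in>U. if \<alpha> \<in> sym_diff i j then 4 * sqrt r * \<nu> else 1 + 2 * K * r)"
  proof (subst sum_Pow_Pow_prod[OF U(2)], intro prod.cong refl)
    fix \<alpha> assume "\<alpha> \<in> U"
    have [simp]: "\<bar>r\<bar> = r" "\<bar>K\<bar> = K" "sqrt r * sqrt r = r" "sqrt K * sqrt K = K" "sqrt r * (sqrt r * z) = r * z" 
      "sqrt K * (sqrt K * z) = K * z" for z
      using r K by (auto simp: mult.assoc[symmetric])
    show "sqrt r ^ of_bool True * sqrt r ^ of_bool True * f \<alpha> True True +
         sqrt r ^ of_bool True * sqrt r ^ of_bool False * f \<alpha> True False +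
         (sqrt r ^ of_bool False * sqrt r ^ of_bool True * f \<alpha> False True +
          sqrt r ^ of_bool False * sqrt r ^ of_bool False * f \<alpha> False False) =
         (if \<alpha> \<in> sym_diff i j then 4 * sqrt r * \<nu> else 1 + 2 * K * r)"
      using \<open>\<alpha> \<in> U\<close> by (auto simp: U_def f_def moment_bound_def \<nu>_def real_sqrt_mult mult_ac)
  qed
  also have "\<dots> = (4 * sqrt r * \<nu>) ^ card (sym_diff i j) * (1 + 2 * K * r) ^ card (i \<inter> j)"
  proof -
    have "U \<inter> {\<alpha>. \<alpha> \<in> sym_diff i j} = sym_diff i j" "U \<inter> - {\<alpha>. \<alpha> \<in> sym_diff i j} = i \<inter> j"
      by (auto simp: U_def)
    then show ?thesis using U(2) by (simp only: prod.If_cases prod_constant)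
  qed
  finally show ?thesis by (simp add: T_def p_def)
qed

text \<open>The sets \<open>k\<close> are grouped by their intersection \<open>m\<close> with
  \<open>i\<close>. At most \<open>r ^ card m\<close> times the number of all sets contain
  \<open>m\<close>, and summing \<open>(K * r) ^ card m\<close> over the subsets of \<open>i\<close>
  gives a power of \<open>1 + K * r\<close>. These are the row sums for the diagonal part.\<close>

lemma sum_power_card_Int_le:
  fixes K :: real and N i :: "'i set"
  assumes N: "finite N" "d \<le> card N" and i: "i \<subseteq> N" and K: "0 \<le> K"
  shows "(\<Sum>k | k \<subseteq> N \<and> card k = d. K ^ card (i \<inter> k)) \<le>
    real (card N choose d) * (1 + K * (real d / real (card N))) ^ card i"
proof -
  define r where "r = real d / real (card N)"
  let ?S = "{k. k \<subseteq> N \<and> card k = d}"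
  have fin: "finite i" "finite ?S" using N i by (auto intro: finite_subset)
  have "(\<Sum>k\<in>?S. K ^ card (i \<inter> k)) = (\<Sum>m\<in>Pow i. \<Sum>k | k \<in> ?S \<and> i \<inter> k = m. K ^ card (i \<inter> k))"
    using fin by (intro sum.group[symmetric]) auto
  also have "\<dots> = (\<Sum>m\<in>Pow i. real (card {k. k \<in> ?S \<and> i \<inter> k = m}) * K ^ card m)"
    by (intro sum.cong) auto
  also have "\<dots> \<le> (\<Sum>m\<in>Pow i. real (card N choose d) * r ^ card m * K ^ card m)"
  proof (intro sum_mono mult_right_mono)
    fix m assume m: "m \<in> Pow i"
    have "card {k. k \<in> ?S \<and> i \<inter> k = m} \<le> card {k. k \<subseteq> N \<and> card k = d \<and> m \<subseteq> k}"
      using N by (intro card_mono) auto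
    also have "real \<dots> \<le> real (card N choose d) * r ^ card m"
      unfolding r_def using N m i by (intro card_supersets_le) auto
    finally show "real (card {k. k \<in> ?S \<and> i \<inter> k = m}) \<le> real (card N choose d) * r ^ card m"
      by simp
  qed (use K in auto)
  also have "\<dots> = real (card N choose d) * (\<Sum>m\<in>Pow i. \<Prod>\<alpha>\<in>i. (K * r) ^ of_bool (\<alpha> \<in> m))"
    unfolding sum_distrib_left
  proof (intro sum.cong refl)
    fix m assume "m \<in> Pow i"
    then have "(\<Prod>\<alpha>\<in>i. (K * r) ^ of_bool (\<alpha> \<in> m)) = (K * r) ^ card m"
      using power_card_eq_prod[OF fin(1), of m "K * r"] by simp
    also have "\<dots> = r ^ card m * K ^ card m"
      by (simp add: power_mult_distrib)
    finally show "real (card N choose d) * r ^ card m * K ^ card m =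
        real (card N choose d) * (\<Prod>\<alpha>\<in>i. (K * r) ^ of_bool (\<alpha> \<in> m))"
      by (simp only: mult.assoc)
  qed
  also have "\<dots> = real (card N choose d) * (1 + K * r) ^ card i"
    using sum_Pow_prod[OF fin(1), of "\<lambda>_ b. (K * r) ^ of_bool b"] by (simp add: add.commute)
  finally show ?thesis by (simp add: r_def)
qed

section \<open>Elementary inequalities and the variance with values in [0, infinity]\<close>

lemma square_add_le: "(y + z)\<^sup>2 \<le> 4 * y\<^sup>2 + 4 / 3 * z\<^sup>2" for y z :: real
proof -
  have "4 * y\<^sup>2 + 4 / 3 * z\<^sup>2 - (y + z)\<^sup>2 = (3 * y - z)\<^sup>2 / 3"
    by (simp add: power2_eq_square field_simps)
  then show ?thesis using zero_le_power2[of "3 * y - z"] by linarith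
qed

lemma one_plus_power_le_exp: "0 \<le> z \<Longrightarrow> (1 + z) ^ d \<le> exp (real d * z)" for z :: real
  using power_mono[OF exp_ge_add_one_self, of z d] by (simp add: exp_of_nat_mult)

lemma (in prob_space) ennvariance_cong:
  assumes "\<And>\<omega>. \<omega> \<in> space M \<Longrightarrow> Y \<omega> = Z \<omega>"
  shows "ennvariance Y = ennvariance Z"
proof -
  have "expectation Y = expectation Z"
    using assms by (intro Bochner_Integration.integral_cong) auto
  then show ?thesis
    unfolding ennvariance_def using assms by (intro nn_integral_cong) auto
qed

lemma (in prob_space) ennvariance_const: "ennvariance (\<lambda>_. c) = 0"
  by (simp add: ennvariance_def prob_space)

text \<open>The mean square deviation from \<open>c\<close> exceeds the variance by the square of
  the distance from \<open>c\<close> to the mean, so any centre gives an upper bound and the mean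
  need not be computed. Square-integrability around \<open>c\<close> also makes \<open>Y\<close>
  integrable, so \<open>expectation Y\<close> is the true mean and not a default value.\<close>

lemma (in prob_space) ennvariance_le:
  assumes [measurable]: "Y \<in> borel_measurable M" and int: "integrable M (\<lambda>\<omega>. (Y \<omega> - c)\<^sup>2)"
  shows "ennvariance Y \<le> ennreal (expectation (\<lambda>\<omega>. (Y \<omega> - c)\<^sup>2))"
proof -
  define \<mu> where "\<mu> = expectation Y"
  have int1: "integrable M (\<lambda>\<omega>. Y \<omega> - c)"
    by (rule square_integrable_imp_integrable) (use int in auto)
  then have "integrable M (\<lambda>\<omega>. Y \<omega> - c + c)"
    by (intro Bochner_Integration.integrable_add) auto
  then have intY: "integrable M Y" by simp
  have eq: "(\<lambda>\<omega>. (Y \<omega> - \<mu>)\<^sup>2) = (\<lambda>\<omega>. (Y \<omega> - c)\<^sup>2 - 2 * (\<mu> - c) * (Y \<omega> - c) + (\<mu> - c)\<^sup>2)"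
    by (auto simp: power2_eq_square algebra_simps)
  have int2: "integrable M (\<lambda>\<omega>. (Y \<omega> - \<mu>)\<^sup>2)"
    unfolding eq using int int1 by simp
  have "expectation (\<lambda>\<omega>. (Y \<omega> - \<mu>)\<^sup>2) = expectation (\<lambda>\<omega>. (Y \<omega> - c)\<^sup>2) - (\<mu> - c)\<^sup>2"
    unfolding eq using int int1 intY
    by (simp add: prob_space \<mu>_def[symmetric]) (simp add: power2_eq_square algebra_simps)
  then have "expectation (\<lambda>\<omega>. (Y \<omega> - \<mu>)\<^sup>2) \<le> expectation (\<lambda>\<omega>. (Y \<omega> - c)\<^sup>2)" by simp
  then show ?thesis
    unfolding ennvariance_def \<mu>_def[symmetric] using int2
    by (subst nn_integral_eq_integral) (auto intro: ennreal_leI)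
qed

section \<open>Moments of products of independent variables\<close>

text \<open>Here \<open>K\<close> is a real upper bound for the fourth moments, all of which are
  finite; an infinite maximum is treated outside the locale. Since \<open>N\<close> is nonempty,
  \<open>K\<close> is at least 1.\<close>

locale fourth_moment_sample = prob_space M for M :: "'a measure" +
  fixes X :: "'i \<Rightarrow> 'a \<Rightarrow> real" and N :: "'i set" and K :: real
  assumes finite_N: "finite N" and N_nonempty: "N \<noteq> {}"
    and indep: "indep_vars (\<lambda>_. borel) X N"
    and mean: "\<And>\<alpha>. \<alpha> \<in> N \<Longrightarrow> expectation (X \<alpha>) = 0"
    and second_moment: "\<And>\<alpha>. \<alpha> \<in> N \<Longrightarrow> expectation (\<lambda>\<omega>. X \<alpha> \<omega> ^ 2) = 1"
    and integrable_fourth: "\<And>\<alpha>. \<alpha> \<in> N \<Longrightarrow> integrable M (\<lambda>\<omega>. X \<alpha> \<omega> ^ 4)"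
    and fourth_moment_le: "\<And>\<alpha>. \<alpha> \<in> N \<Longrightarrow> expectation (\<lambda>\<omega>. X \<alpha> \<omega> ^ 4) \<le> K"
begin

lemma X_measurable [measurable]: "\<alpha> \<in> N \<Longrightarrow> X \<alpha> \<in> borel_measurable M"
  using indep by (auto simp: indep_vars_def)

lemma integrable_power:
  assumes "\<alpha> \<in> N" "c \<le> 4"
  shows "integrable M (\<lambda>\<omega>. X \<alpha> \<omega> ^ c)"
proof (rule Bochner_Integration.integrable_bound)
  show "integrable M (\<lambda>\<omega>. 1 + X \<alpha> \<omega> ^ 4)"
    using integrable_fourth assms by simp
  have "\<bar>z ^ c\<bar> \<le> 1 + z ^ 4" for z :: real
  proof (cases "\<bar>z\<bar> \<le> 1")
    case True
    then have "\<bar>z ^ c\<bar> \<le> 1" by (simp add: power_abs power_le_one)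
    then show ?thesis by (simp add: add_increasing2)
  next
    case False
    then have "\<bar>z\<bar> ^ c \<le> \<bar>z\<bar> ^ 4" using assms(2) by (intro power_increasing) auto
    then show ?thesis by (simp add: power_abs power_even_abs)
  qed
  then show "AE \<omega> in M. norm (X \<alpha> \<omega> ^ c) \<le> norm (1 + X \<alpha> \<omega> ^ 4)"
    by (intro AE_I2) (simp add: order_trans[OF _ abs_ge_self])
qed (use assms in measurable)

text \<open>The variance of the square of \<open>X \<alpha>\<close> is nonnegative, and this square
  has mean 1.\<close>

lemma fourth_moment_ge_1:
  assumes "\<alpha> \<in> N"
  shows "1 \<le> expectation (\<lambda>\<omega>. X \<alpha> \<omega> ^ 4)"
proof -
  note int = integrable_power[OF assms]
  have "0 \<le> expectation (\<lambda>\<omega>. (X \<alpha> \<omega> ^ 2 - 1) ^ 2)" by simp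
  also have "(\<lambda>\<omega>. (X \<alpha> \<omega> ^ 2 - 1) ^ 2) = (\<lambda>\<omega>. X \<alpha> \<omega> ^ 4 - 2 * X \<alpha> \<omega> ^ 2 + 1)"
    by (simp add: power2_diff algebra_simps flip: power_mult)
  also have "expectation \<dots> = expectation (\<lambda>\<omega>. X \<alpha> \<omega> ^ 4) - 2 * 1 + 1"
    using int[of 4] int[of 2] second_moment[OF assms] by (simp add: prob_space)
  finally show ?thesis by simp
qed

lemma K_ge_1: "1 \<le> K"
proof -
  obtain \<alpha> where "\<alpha> \<in> N" using N_nonempty by blast
  then show ?thesis using fourth_moment_ge_1 fourth_moment_le by fastforce
qed

text \<open>Pointwise, twice the absolute third power is at most
  \<open>sqrt K * z ^ 2 + z ^ 4 / sqrt K\<close>. The weight \<open>sqrt K\<close> is chosen so that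
  each of the two terms has expectation at most \<open>sqrt K\<close>.\<close>

lemma abs_third_moment_le:
  assumes "\<alpha> \<in> N"
  shows "\<bar>expectation (\<lambda>\<omega>. X \<alpha> \<omega> ^ 3)\<bar> \<le> sqrt K"
proof -
  note int = integrable_power[OF assms]
  have K: "0 < sqrt K" using K_ge_1 by simp
  have "\<bar>z ^ 3\<bar> \<le> (sqrt K * z ^ 2 + z ^ 4 / sqrt K) / 2" for z :: real
  proof -
    have "0 \<le> z ^ 2 * (sqrt K - \<bar>z\<bar>) ^ 2 / sqrt K" using K by simp
    also have "\<dots> = sqrt K * z ^ 2 + z ^ 4 / sqrt K - 2 * \<bar>z ^ 3\<bar>"
      using K by (simp add: power_abs power2_diff field_simps) 
         (simp add: power2_eq_square power3_eq_cube power4_eq_xxxx algebra_simps abs_mult)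
    finally show ?thesis by simp
  qed
  then have "expectation (\<lambda>\<omega>. \<bar>X \<alpha> \<omega> ^ 3\<bar>) \<le>
      expectation (\<lambda>\<omega>. (sqrt K * X \<alpha> \<omega> ^ 2 + X \<alpha> \<omega> ^ 4 / sqrt K) / 2)"
    using int[of 2] int[of 3] int[of 4] by (intro integral_mono) auto
  also have "\<dots> = (sqrt K * 1 + expectation (\<lambda>\<omega>. X \<alpha> \<omega> ^ 4) / sqrt K) / 2"
    using int[of 2] int[of 4] second_moment[OF assms] by simp
  also have "\<dots> \<le> (sqrt K * 1 + K / sqrt K) / 2"
    using fourth_moment_le[OF assms] K by (simp add: divide_right_mono)
  also have "\<dots> = sqrt K" using K_ge_1 by (simp add: real_div_sqrt)
  finally show ?thesis
    using integral_abs_bound[of M "\<lambda>\<omega>. X \<alpha> \<omega> ^ 3"] by linarith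
qed

lemma abs_moment_le:
  assumes "\<alpha> \<in> N" "c \<le> 4"
  shows "\<bar>expectation (\<lambda>\<omega>. X \<alpha> \<omega> ^ c)\<bar> \<le> moment_bound K c"
proof -
  consider "c = 0" | "c = 1" | "c = 2" | "c = 3" | "c = 4" using assms(2) by linarith
  then show ?thesis
  proof cases
    case 5
    then show ?thesis
      using fourth_moment_ge_1[OF assms(1)] fourth_moment_le[OF assms(1)] by (simp add: moment_bound_def)
  qed (use mean[OF assms(1)] second_moment[OF assms(1)] abs_third_moment_le[OF assms(1)] in
      \<open>auto simp: moment_bound_def prob_space\<close>)
qed

lemma
  assumes "\<And>\<alpha>. \<alpha> \<in> N \<Longrightarrow> c \<alpha> \<le> 4"
  shows integrable_prod_powers: "integrable M (\<lambda>\<omega>. \<Prod>\<alpha>\<in>N. X \<alpha> \<omega> ^ c \<alpha>)"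
    and expectation_prod_powers:
      "expectation (\<lambda>\<omega>. \<Prod>\<alpha>\<in>N. X \<alpha> \<omega> ^ c \<alpha>) = (\<Prod>\<alpha>\<in>N. expectation (\<lambda>\<omega>. X \<alpha> \<omega> ^ c \<alpha>))"
proof -
  have "indep_vars (\<lambda>_. borel) (\<lambda>\<alpha> \<omega>. X \<alpha> \<omega> ^ c \<alpha>) N"
    by (rule indep_vars_compose2[OF indep]) measurable
  then show "integrable M (\<lambda>\<omega>. \<Prod>\<alpha>\<in>N. X \<alpha> \<omega> ^ c \<alpha>)"
    "expectation (\<lambda>\<omega>. \<Prod>\<alpha>\<in>N. X \<alpha> \<omega> ^ c \<alpha>) = (\<Prod>\<alpha>\<in>N. expectation (\<lambda>\<omega>. X \<alpha> \<omega> ^ c \<alpha>))"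
    using finite_N integrable_power assms
    by (auto intro!: indep_vars_integrable indep_vars_lebesgue_integral)
qed

text \<open>These are the entries of the random vector, indexed directly by sets instead of by
  coordinates.\<close>

definition monomial :: "'i set \<Rightarrow> 'a \<Rightarrow> real" where
  "monomial i \<omega> = (\<Prod>\<alpha>\<in>i. X \<alpha> \<omega>)"

lemma monomial_product:
  assumes "i \<subseteq> N" "j \<subseteq> N" "k \<subseteq> N" "l \<subseteq> N"
  shows "monomial i \<omega> * monomial j \<omega> * (monomial k \<omega> * monomial l \<omega>) =
    (\<Prod>\<alpha>\<in>N. X \<alpha> \<omega> ^ multiplicity4 i j k l \<alpha>)"
proof -
  have "monomial i \<omega> = (\<Prod>\<alpha>\<in>N. X \<alpha> \<omega> ^ of_bool (\<alpha> \<in> i))" if "i \<subseteq> N" for i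
  proof -
    have "(\<Prod>\<alpha>\<in>N. X \<alpha> \<omega> ^ of_bool (\<alpha> \<in> i)) = (\<Prod>\<alpha>\<in>i. X \<alpha> \<omega> ^ of_bool (\<alpha> \<in> i))"
      using finite_N that by (intro prod.mono_neutral_right) auto
    then show ?thesis by (simp add: monomial_def)
  qed
  then show ?thesis
    using assms by (simp add: multiplicity4_def power_add prod.distrib mult.assoc)
qed

lemma multiplicity4_le: "multiplicity4 i j k l \<alpha> \<le> 4"
  by (simp add: multiplicity4_def of_bool_def)

lemma
  assumes "i \<subseteq> N" "j \<subseteq> N" "k \<subseteq> N" "l \<subseteq> N"
  shows integrable_monomials4:
      "integrable M (\<lambda>\<omega>. monomial i \<omega> * monomial j \<omega> * (monomial k \<omega> * monomial l \<omega>))"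
    and expectation_monomials4:
      "expectation (\<lambda>\<omega>. monomial i \<omega> * monomial j \<omega> * (monomial k \<omega> * monomial l \<omega>)) =
        (\<Prod>\<alpha>\<in>N. expectation (\<lambda>\<omega>. X \<alpha> \<omega> ^ multiplicity4 i j k l \<alpha>))"
    and abs_expectation_monomials4_le:
      "\<bar>expectation (\<lambda>\<omega>. monomial i \<omega> * monomial j \<omega> * (monomial k \<omega> * monomial l \<omega>))\<bar> \<le>
        (\<Prod>\<alpha>\<in>N. moment_bound K (multiplicity4 i j k l \<alpha>))"
proof -
  show "integrable M (\<lambda>\<omega>. monomial i \<omega> * monomial j \<omega> * (monomial k \<omega> * monomial l \<omega>))"
    and *: "expectation (\<lambda>\<omega>. monomial i \<omega> * monomial j \<omega> * (monomial k \<omega> * monomial l \<omega>)) =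
        (\<Prod>\<alpha>\<in>N. expectation (\<lambda>\<omega>. X \<alpha> \<omega> ^ multiplicity4 i j k l \<alpha>))"
    unfolding monomial_product[OF assms]
    by (rule integrable_prod_powers expectation_prod_powers multiplicity4_le)+
  show "\<bar>expectation (\<lambda>\<omega>. monomial i \<omega> * monomial j \<omega> * (monomial k \<omega> * monomial l \<omega>))\<bar> \<le>
        (\<Prod>\<alpha>\<in>N. moment_bound K (multiplicity4 i j k l \<alpha>))"
    unfolding * abs_prod by (intro prod_mono conjI abs_ge_zero abs_moment_le multiplicity4_le)
qed

text \<open>Only the indices in \<open>i \<inter> k\<close> occur with multiplicity 4; all others
  have multiplicity 0 or 2 and moment 1. The expectation is thus a product of fourth moments over
  \<open>i \<inter> k\<close>, each between 1 and \<open>K\<close>.\<close>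

lemma expectation_monomial_squares:
  assumes "i \<subseteq> N" "k \<subseteq> N"
  shows "1 \<le> expectation (\<lambda>\<omega>. monomial i \<omega> * monomial i \<omega> * (monomial k \<omega> * monomial k \<omega>))"
    and "expectation (\<lambda>\<omega>. monomial i \<omega> * monomial i \<omega> * (monomial k \<omega> * monomial k \<omega>)) \<le> K ^ card (i \<inter> k)"
proof -
  note e = expectation_monomials4[OF assms(1) assms(1) assms(2) assms(2)]
  have m: "expectation (\<lambda>\<omega>. X \<alpha> \<omega> ^ multiplicity4 i i k k \<alpha>) =
      (if \<alpha> \<in> i \<inter> k then expectation (\<lambda>\<omega>. X \<alpha> \<omega> ^ 4) else 1)" if "\<alpha> \<in> N" for \<alpha>
    using second_moment[OF that] by (auto simp: multiplicity4_def prob_space numeral_eq_Suc)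
  show "1 \<le> expectation (\<lambda>\<omega>. monomial i \<omega> * monomial i \<omega> * (monomial k \<omega> * monomial k \<omega>))"
    unfolding e using m fourth_moment_ge_1 by (intro prod_ge_1) auto
  have "(\<Prod>\<alpha>\<in>N. expectation (\<lambda>\<omega>. X \<alpha> \<omega> ^ multiplicity4 i i k k \<alpha>)) \<le> (\<Prod>\<alpha>\<in>N. K ^ of_bool (\<alpha> \<in> i \<inter> k))"
  proof (intro prod_mono)
    fix \<alpha> assume "\<alpha> \<in> N"
    then show "0 \<le> expectation (\<lambda>\<omega>. X \<alpha> \<omega> ^ multiplicity4 i i k k \<alpha>) \<and>
        expectation (\<lambda>\<omega>. X \<alpha> \<omega> ^ multiplicity4 i i k k \<alpha>) \<le> K ^ of_bool (\<alpha> \<in> i \<inter> k)"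
      using m[of \<alpha>] fourth_moment_ge_1[of \<alpha>] fourth_moment_le[of \<alpha>] by auto
  qed
  also have "\<dots> = K ^ card (i \<inter> k)"
    using assms by (intro power_card_eq_prod[symmetric] finite_N) auto
  finally show "expectation (\<lambda>\<omega>. monomial i \<omega> * monomial i \<omega> * (monomial k \<omega> * monomial k \<omega>)) \<le> K ^ card (i \<inter> k)"
    unfolding e .
qed

text \<open>For empty \<open>k\<close> the lower and upper bounds of
  \<open>expectation_monomial_squares\<close> coincide, since the exponent of \<open>K\<close> is
  0.\<close>

lemma
  assumes "i \<subseteq> N"
  shows integrable_monomial_square: "integrable M (\<lambda>\<omega>. monomial i \<omega> * monomial i \<omega>)"
    and expectation_monomial_square: "expectation (\<lambda>\<omega>. monomial i \<omega> * monomial i \<omega>) = 1"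
  using expectation_monomial_squares[OF assms empty_subsetI]
    integrable_monomials4[OF assms assms empty_subsetI empty_subsetI]
  by (simp_all add: monomial_def)

section \<open>Second moments of the diagonal and off-diagonal parts\<close>

definition diag_form :: "nat \<Rightarrow> ('i set \<Rightarrow> 'i set \<Rightarrow> real) \<Rightarrow> 'a \<Rightarrow> real" where
  "diag_form d a \<omega> = (\<Sum>i | i \<subseteq> N \<and> card i = d. a i i * (monomial i \<omega> * monomial i \<omega> - 1))"

text \<open>A single sum over ordered pairs, so that the Schur test can be applied with pairs as
  indices.\<close>

definition off_diag_form :: "nat \<Rightarrow> ('i set \<Rightarrow> 'i set \<Rightarrow> real) \<Rightarrow> 'a \<Rightarrow> real" where
  "off_diag_form d a \<omega> =
     (\<Sum>(i, j)\<in>{(i, j). (i \<subseteq> N \<and> card i = d) \<and> (j \<subseteq> N \<and> card j = d) \<and> i \<noteq> j}.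
        a i j * (monomial i \<omega> * monomial j \<omega>))"

text \<open>The kernel of the second moment consists of the covariances of the squared entries,
  which lie between 0 and \<open>K ^ card (i \<inter> k) - 1\<close>. The Schur test with constant
  weights and the row sums of \<open>sum_power_card_Int_le\<close> conclude.\<close>

lemma
  assumes d: "d \<le> card N"
  defines "p \<equiv> real (card N choose d)" and "r \<equiv> real d / real (card N)"
  shows integrable_diag_form_square: "integrable M (\<lambda>\<omega>. (diag_form d a \<omega>)\<^sup>2)"
    and expectation_diag_form_square_le: "expectation (\<lambda>\<omega>. (diag_form d a \<omega>)\<^sup>2) \<le>
      p * ((1 + K * r) ^ d - 1) * (\<Sum>i | i \<subseteq> N \<and> card i = d. (a i i)\<^sup>2)"
proof -
  define S where "S = {i. i \<subseteq> N \<and> card i = d}"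
  define Z where "Z i k \<omega> = (monomial i \<omega> * monomial i \<omega> - 1) * (monomial k \<omega> * monomial k \<omega> - 1)" for i k \<omega>
  have S: "i \<subseteq> N" "card i = d" if "i \<in> S" for i using that by (auto simp: S_def)
  have finS: "finite S" using finite_N by (simp add: S_def)
  have Z_eq: "Z i k = (\<lambda>\<omega>. monomial i \<omega> * monomial i \<omega> * (monomial k \<omega> * monomial k \<omega>)
      - monomial i \<omega> * monomial i \<omega> - monomial k \<omega> * monomial k \<omega> + 1)" for i k
    by (auto simp: Z_def algebra_simps)
  have Z_int: "integrable M (Z i k)" if "i \<in> S" "k \<in> S" for i k
    unfolding Z_eq using S that
    by (intro Bochner_Integration.integrable_add Bochner_Integration.integrable_diff
        integrable_monomials4 integrable_monomial_square) auto
  have Z_abs: "\<bar>expectation (Z i k)\<bar> \<le> K ^ card (i \<inter> k) - 1" if "i \<in> S" "k \<in> S" for i k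
  proof -
    have "expectation (Z i k) =
      expectation (\<lambda>\<omega>. monomial i \<omega> * monomial i \<omega> * (monomial k \<omega> * monomial k \<omega>)) - 1 - 1 + 1"
      unfolding Z_eq using S(1)[OF that(1)] S(1)[OF that(2)]
      by (simp add: integrable_monomials4 integrable_monomial_square expectation_monomial_square prob_space)
    then show ?thesis
      using expectation_monomial_squares[OF S(1)[OF that(1)] S(1)[OF that(2)]] by simp
  qed
  have sq: "(\<lambda>\<omega>. (diag_form d a \<omega>)\<^sup>2) = (\<lambda>\<omega>. \<Sum>i\<in>S. \<Sum>k\<in>S. a i i * a k k * Z i k \<omega>)"
    by (auto simp: diag_form_def S_def[symmetric] power2_eq_square sum_product Z_def mult_ac)
  show "integrable M (\<lambda>\<omega>. (diag_form d a \<omega>)\<^sup>2)"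
    unfolding sq by (intro Bochner_Integration.integrable_sum integrable_mult_right Z_int)
  have "expectation (\<lambda>\<omega>. (diag_form d a \<omega>)\<^sup>2) = (\<Sum>i\<in>S. \<Sum>k\<in>S. a i i * a k k * expectation (Z i k))"
    unfolding sq by (simp add: Z_int)
  also have "\<dots> \<le> (\<Sum>i\<in>S. \<Sum>k\<in>S. \<bar>a i i\<bar> * \<bar>a k k\<bar> * (K ^ card (i \<inter> k) - 1))"
  proof (intro sum_mono)
    fix i k assume ik: "i \<in> S" "k \<in> S"
    have "a i i * a k k * expectation (Z i k) \<le> \<bar>a i i * a k k * expectation (Z i k)\<bar>" by simp
    also have "\<dots> \<le> \<bar>a i i\<bar> * \<bar>a k k\<bar> * (K ^ card (i \<inter> k) - 1)"
      unfolding abs_mult using Z_abs[OF ik] by (intro mult_left_mono) auto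
    finally show "a i i * a k k * expectation (Z i k) \<le> \<bar>a i i\<bar> * \<bar>a k k\<bar> * (K ^ card (i \<inter> k) - 1)" .
  qed
  also have "\<dots> \<le> p * ((1 + K * r) ^ d - 1) * (\<Sum>i\<in>S. (a i i)\<^sup>2)"
  proof (rule weighted_Schur_test[where u = "\<lambda>i. a i i" and g = "\<lambda>i k. K ^ card (i \<inter> k) - 1" and w = "\<lambda>_. 1"])
    fix i assume i: "i \<in> S"
    have "(\<Sum>k\<in>S. (K ^ card (i \<inter> k) - 1) * 1) = (\<Sum>k\<in>S. K ^ card (i \<inter> k)) - p"
      using finite_N by (simp add: sum_subtractf S_def p_def n_subsets)
    also have "\<dots> \<le> p * (1 + K * r) ^ d - p"
      using sum_power_card_Int_le[OF finite_N d S(1)[OF i], of K] K_ge_1 S(2)[OF i]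
      by (simp add: S_def p_def r_def)
    finally show "(\<Sum>k\<in>S. (K ^ card (i \<inter> k) - 1) * 1) \<le> p * ((1 + K * r) ^ d - 1) * 1"
      by (simp add: algebra_simps)
  qed (use K_ge_1 in \<open>auto simp: Int_commute\<close>)
  finally show "expectation (\<lambda>\<omega>. (diag_form d a \<omega>)\<^sup>2) \<le>
      p * ((1 + K * r) ^ d - 1) * (\<Sum>i | i \<subseteq> N \<and> card i = d. (a i i)\<^sup>2)"
    by (simp add: S_def)
qed

text \<open>The Schur test is applied to the kernel \<open>G\<close>, which dominates the mixed
  moments in absolute value. The assumption \<open>1 \<le> d\<close> makes \<open>r\<close>, and
  with it the weights, positive; \<open>16 * d \<le> card N\<close> makes \<open>4 * sqrt r\<close>
  at most 1, so that its powers decrease.\<close>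

lemma
  assumes d: "1 \<le> d" "16 * d \<le> card N"
  defines "p \<equiv> real (card N choose d)" and "r \<equiv> real d / real (card N)"
  shows integrable_off_diag_form_square: "integrable M (\<lambda>\<omega>. (off_diag_form d a \<omega>)\<^sup>2)"
    and expectation_off_diag_form_square_le: "expectation (\<lambda>\<omega>. (off_diag_form d a \<omega>)\<^sup>2) \<le>
      p * (16 * r * (1 + 2 * K * r) ^ d) *
      (\<Sum>(i, j)\<in>{(i, j). (i \<subseteq> N \<and> card i = d) \<and> (j \<subseteq> N \<and> card j = d) \<and> i \<noteq> j}. (a i j)\<^sup>2)"
proof -
  define S where "S = {i. i \<subseteq> N \<and> card i = d}"
  define P where "P = {(i, j). (i \<subseteq> N \<and> card i = d) \<and> (j \<subseteq> N \<and> card j = d) \<and> i \<noteq> j}"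
  define m where "m s \<omega> = monomial (fst s) \<omega> * monomial (snd s) \<omega>" for s \<omega>
  define b where "b s = a (fst s) (snd s)" for s
  define G where "G s t = (\<Prod>\<alpha>\<in>N. moment_bound K (multiplicity4 (fst s) (snd s) (fst t) (snd t) \<alpha>))" for s t
  define \<nu> where "\<nu> = sqrt (K * r) / 2"
  define w where "w s = \<nu> ^ card (sym_diff (fst s) (snd s))" for s :: "'i set \<times> 'i set"
  have finS: "finite S" using finite_N by (simp add: S_def)
  have PS: "P \<subseteq> S \<times> S" by (auto simp: P_def S_def)
  have sub: "fst s \<subseteq> N" "snd s \<subseteq> N" if "s \<in> P" for s using that by (auto simp: P_def)
  have card_N: "0 < card N" using d by simp
  have r: "0 < r" "16 * r \<le> 1" using d card_N by (auto simp: r_def field_simps)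
  have K: "0 < K" using K_ge_1 by simp
  have \<nu>: "0 < \<nu>" using K r by (simp add: \<nu>_def)
  have G_nonneg: "0 \<le> G s t" for s t
    using K by (simp add: G_def prod_nonneg moment_bound_nonneg)
  have sq: "(\<lambda>\<omega>. (off_diag_form d a \<omega>)\<^sup>2) = (\<lambda>\<omega>. \<Sum>s\<in>P. \<Sum>t\<in>P. b s * b t * (m s \<omega> * m t \<omega>))"
    unfolding off_diag_form_def P_def[symmetric]
    by (simp add: power2_eq_square sum_product m_def b_def case_prod_unfold mult_ac)
  have int: "integrable M (\<lambda>\<omega>. m s \<omega> * m t \<omega>)" if "s \<in> P" "t \<in> P" for s t
    unfolding m_def by (intro integrable_monomials4 sub that)
  show "integrable M (\<lambda>\<omega>. (off_diag_form d a \<omega>)\<^sup>2)"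
    unfolding sq by (intro Bochner_Integration.integrable_sum integrable_mult_right int)
  have "expectation (\<lambda>\<omega>. (off_diag_form d a \<omega>)\<^sup>2) =
      (\<Sum>s\<in>P. \<Sum>t\<in>P. b s * b t * expectation (\<lambda>\<omega>. m s \<omega> * m t \<omega>))"
    unfolding sq by (simp add: int)
  also have "\<dots> \<le> (\<Sum>s\<in>P. \<Sum>t\<in>P. \<bar>b s\<bar> * \<bar>b t\<bar> * G s t)"
  proof (intro sum_mono)
    fix s t assume st: "s \<in> P" "t \<in> P"
    have "b s * b t * expectation (\<lambda>\<omega>. m s \<omega> * m t \<omega>) \<le> \<bar>b s * b t * expectation (\<lambda>\<omega>. m s \<omega> * m t \<omega>)\<bar>"
      by simp
    also have "\<dots> \<le> \<bar>b s\<bar> * \<bar>b t\<bar> * G s t"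
      unfolding abs_mult[of "b s * b t"] abs_mult[of "b s"] m_def G_def
      by (intro mult_left_mono abs_expectation_monomials4_le sub st) auto
    finally show "b s * b t * expectation (\<lambda>\<omega>. m s \<omega> * m t \<omega>) \<le> \<bar>b s\<bar> * \<bar>b t\<bar> * G s t" .
  qed
  also have "\<dots> \<le> p * (16 * r * (1 + 2 * K * r) ^ d) * (\<Sum>s\<in>P. (b s)\<^sup>2)"
  proof (rule weighted_Schur_test[where u = b and g = G and w = w])
    fix s assume s: "s \<in> P"
    define i j where "i = fst s" and "j = snd s"
    have ij: "i \<in> S" "j \<in> S" "i \<noteq> j"
      using s by (simp_all add: i_def j_def P_def S_def case_prod_unfold)
    have fin: "finite i" "finite j" using ij by (auto simp: S_def intro: rev_finite_subset[OF finite_N])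
    \<comment> \<open>The row bound concerns all pairs of sets; the added terms with equal
      components are nonnegative.\<close>
    have "(\<Sum>t\<in>P. G s t * w t) \<le> (\<Sum>t\<in>S \<times> S. G s t * w t)"
      using PS finS \<nu> G_nonneg by (intro sum_mono2) (auto simp: w_def)
    also have "\<dots> = (\<Sum>k\<in>S. \<Sum>l\<in>S. (\<Prod>\<alpha>\<in>N. moment_bound K (multiplicity4 i j k l \<alpha>)) * \<nu> ^ card (sym_diff k l))"
      by (simp add: sum.cartesian_product G_def w_def i_def j_def case_prod_unfold)
    also have "\<dots> \<le> p * ((4 * sqrt r * \<nu>) ^ card (sym_diff i j) * (1 + 2 * K * r) ^ card (i \<inter> j))"
      using weighted_row_sum_le[OF finite_N _ _ _ K, of d i j] ij d
      by (simp add: p_def r_def \<nu>_def S_def)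
    \<comment> \<open>Two distinct sets of the same size each have an element outside the other, so
      the exponent of \<open>4 * sqrt r\<close> is at least 2 and can be lowered to 2. The power of
      \<nu> is kept in full, because it is the weight \<open>w s\<close> required on the
      right.\<close>
    also have "\<dots> \<le> p * ((4 * sqrt r) ^ 2 * \<nu> ^ card (sym_diff i j) * (1 + 2 * K * r) ^ d)"
    proof -
      have "i - j \<noteq> {}" "j - i \<noteq> {}"
        using ij fin by (auto simp: S_def dest: card_subset_eq)
      then have "2 \<le> card (i - j) + card (j - i)"
        using fin by (metis add_mono card_0_eq finite_Diff less_one linorder_not_less one_add_one)
      also have "\<dots> = card (sym_diff i j)"
        using fin by (intro card_Un_disjoint[symmetric]) auto
      finally have "(4 * sqrt r) ^ card (sym_diff i j) \<le> (4 * sqrt r) ^ 2"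
        using r power2_le_imp_le[of "4 * sqrt r" 1]
        by (intro power_decreasing) (auto simp: power_mult_distrib)
      moreover have "(1 + 2 * K * r) ^ card (i \<inter> j) \<le> (1 + 2 * K * r) ^ d"
        using K r ij fin card_mono[of i "i \<inter> j"] by (intro power_increasing) (auto simp: S_def)
      ultimately show ?thesis
        using K r \<nu> unfolding power_mult_distrib[of _ \<nu>]
        by (intro mult_left_mono mult_mono mult_right_mono) (auto simp: p_def)
    qed
    also have "\<dots> = p * (16 * r * (1 + 2 * K * r) ^ d) * w s"
      using r by (simp add: w_def i_def j_def power_mult_distrib)
    finally show "(\<Sum>t\<in>P. G s t * w t) \<le> p * (16 * r * (1 + 2 * K * r) ^ d) * w s" .
  next
    show "G s t = G t s" for s t
      by (simp add: G_def multiplicity4_def add_ac)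
  qed (use \<nu> G_nonneg in \<open>auto simp: w_def\<close>)
  finally show "expectation (\<lambda>\<omega>. (off_diag_form d a \<omega>)\<^sup>2) \<le>
      p * (16 * r * (1 + 2 * K * r) ^ d) *
      (\<Sum>(i, j)\<in>{(i, j). (i \<subseteq> N \<and> card i = d) \<and> (j \<subseteq> N \<and> card j = d) \<and> i \<noteq> j}. (a i j)\<^sup>2)"
    unfolding P_def[symmetric] by (simp add: b_def case_prod_unfold)
qed

section \<open>Variance of the quadratic form\<close>

definition quadratic_form :: "nat \<Rightarrow> ('i set \<Rightarrow> 'i set \<Rightarrow> real) \<Rightarrow> 'a \<Rightarrow> real" where
  "quadratic_form d a \<omega> =
    (\<Sum>i | i \<subseteq> N \<and> card i = d. \<Sum>j | j \<subseteq> N \<and> card j = d. a i j * (monomial i \<omega> * monomial j \<omega>))"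

lemma sum_subsets_split_diagonal:
  fixes f :: "'i set \<Rightarrow> 'i set \<Rightarrow> real"
  shows "(\<Sum>i | i \<subseteq> N \<and> card i = d. \<Sum>j | j \<subseteq> N \<and> card j = d. f i j) =
    (\<Sum>i | i \<subseteq> N \<and> card i = d. f i i) +
    (\<Sum>(i, j)\<in>{(i, j). (i \<subseteq> N \<and> card i = d) \<and> (j \<subseteq> N \<and> card j = d) \<and> i \<noteq> j}. f i j)"
proof -
  define S where "S = {i. i \<subseteq> N \<and> card i = d}"
  define P where "P = {(i, j). (i \<subseteq> N \<and> card i = d) \<and> (j \<subseteq> N \<and> card j = d) \<and> i \<noteq> j}"
  have fin: "finite S" using finite_N by (simp add: S_def)
  have P: "P = S \<times> S - (\<lambda>i. (i, i)) ` S" by (auto simp: P_def S_def)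
  have "(\<Sum>i\<in>S. \<Sum>j\<in>S. f i j) = (\<Sum>(i, j)\<in>S \<times> S. f i j)"
    by (rule sum.cartesian_product)
  also have "\<dots> = (\<Sum>(i, j)\<in>P. f i j) + (\<Sum>(i, j)\<in>(\<lambda>i. (i, i)) ` S. f i j)"
    unfolding P using fin by (intro sum.subset_diff) auto
  also have "(\<Sum>(i, j)\<in>(\<lambda>i. (i, i)) ` S. f i j) = (\<Sum>i\<in>S. f i i)"
    by (subst sum.reindex) (auto simp: inj_on_def)
  finally show ?thesis
    unfolding S_def[symmetric] P_def[symmetric] by simp
qed

lemma quadratic_form_split:
  "quadratic_form d a \<omega> =
    (\<Sum>i | i \<subseteq> N \<and> card i = d. a i i) + (diag_form d a \<omega> + off_diag_form d a \<omega>)"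
  unfolding quadratic_form_def sum_subsets_split_diagonal diag_form_def off_diag_form_def
  by (simp add: right_diff_distrib sum_subtractf)

lemma monomial_measurable: "i \<subseteq> N \<Longrightarrow> monomial i \<in> borel_measurable M"
  unfolding monomial_def by (intro borel_measurable_prod X_measurable) auto

lemma forms_measurable [measurable]:
  "diag_form d a \<in> borel_measurable M" "off_diag_form d a \<in> borel_measurable M"
  unfolding diag_form_def off_diag_form_def case_prod_unfold
  by (auto intro!: borel_measurable_sum borel_measurable_times borel_measurable_diff
      borel_measurable_const monomial_measurable)

text \<open>The variance is estimated around the constant of \<open>quadratic_form_split\<close>.
  The first bound keeps the two parts together, so nothing is lost when one of them vanishes; only
  the second pays the constants 4 and 4/3.\<close>

lemma ennvariance_quadratic_form_le:
  assumes d: "1 \<le> d" "16 * d \<le> card N"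
  shows "ennvariance (quadratic_form d a) \<le> ennreal (expectation (\<lambda>\<omega>. (diag_form d a \<omega> + off_diag_form d a \<omega>)\<^sup>2))"
    and "expectation (\<lambda>\<omega>. (diag_form d a \<omega> + off_diag_form d a \<omega>)\<^sup>2) \<le>
      4 * expectation (\<lambda>\<omega>. (diag_form d a \<omega>)\<^sup>2) + 4 / 3 * expectation (\<lambda>\<omega>. (off_diag_form d a \<omega>)\<^sup>2)"
proof -
  define c where "c = (\<Sum>i | i \<subseteq> N \<and> card i = d. a i i)"
  have q: "quadratic_form d a = (\<lambda>\<omega>. c + (diag_form d a \<omega> + off_diag_form d a \<omega>))"
    by (auto simp: quadratic_form_split c_def)
  have int: "integrable M (\<lambda>\<omega>. (diag_form d a \<omega>)\<^sup>2)" "integrable M (\<lambda>\<omega>. (off_diag_form d a \<omega>)\<^sup>2)"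
    using d by (auto intro: integrable_diag_form_square integrable_off_diag_form_square)
  have int2: "integrable M (\<lambda>\<omega>. 4 * (diag_form d a \<omega>)\<^sup>2 + 4 / 3 * (off_diag_form d a \<omega>)\<^sup>2)"
    using int by (intro Bochner_Integration.integrable_add integrable_mult_right) 
  \<comment> \<open>Pointwise domination by \<open>int2\<close> avoids integrating the cross term
    separately.\<close>
  have int3: "integrable M (\<lambda>\<omega>. (diag_form d a \<omega> + off_diag_form d a \<omega>)\<^sup>2)"
  proof (rule Bochner_Integration.integrable_bound[OF int2])
    show "AE \<omega> in M. norm ((diag_form d a \<omega> + off_diag_form d a \<omega>)\<^sup>2) \<le>
        norm (4 * (diag_form d a \<omega>)\<^sup>2 + 4 / 3 * (off_diag_form d a \<omega>)\<^sup>2)"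
      using square_add_le by (intro AE_I2) (auto intro: order_trans[OF _ abs_ge_self])
  qed measurable
  show "ennvariance (quadratic_form d a) \<le> ennreal (expectation (\<lambda>\<omega>. (diag_form d a \<omega> + off_diag_form d a \<omega>)\<^sup>2))"
    using ennvariance_le[of "quadratic_form d a" c] int3 by (simp add: q)
  have "expectation (\<lambda>\<omega>. (diag_form d a \<omega> + off_diag_form d a \<omega>)\<^sup>2) \<le>
      expectation (\<lambda>\<omega>. 4 * (diag_form d a \<omega>)\<^sup>2 + 4 / 3 * (off_diag_form d a \<omega>)\<^sup>2)"
    by (intro integral_mono int2 int3 square_add_le)
  also have "\<dots> = 4 * expectation (\<lambda>\<omega>. (diag_form d a \<omega>)\<^sup>2) + 4 / 3 * expectation (\<lambda>\<omega>. (off_diag_form d a \<omega>)\<^sup>2)"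
    using int by (subst Bochner_Integration.integral_add) auto
  finally show "expectation (\<lambda>\<omega>. (diag_form d a \<omega> + off_diag_form d a \<omega>)\<^sup>2) \<le>
      4 * expectation (\<lambda>\<omega>. (diag_form d a \<omega>)\<^sup>2) + 4 / 3 * expectation (\<lambda>\<omega>. (off_diag_form d a \<omega>)\<^sup>2)" .
qed

text \<open>For diagonal or zero-diagonal \<open>a\<close> one part of the form is identically 0,
  and so is its share of \<open>F\<close>. In the arbitrary case both second moments are made linear
  in K d^2 / n by exponential estimates.\<close>

lemma
  fixes a :: "'i set \<Rightarrow> 'i set \<Rightarrow> real"
  assumes d: "1 \<le> d" "16 * d \<le> card N"
  defines "p \<equiv> real (card N choose d)" and "r \<equiv> real d / real (card N)"
    and "F \<equiv> (\<Sum>i | i \<subseteq> N \<and> card i = d. \<Sum>j | j \<subseteq> N \<and> card j = d. (a i j)\<^sup>2)"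
  shows ennvariance_diagonal_le: "(\<And>i j. i \<subseteq> N \<Longrightarrow> card i = d \<Longrightarrow> j \<subseteq> N \<Longrightarrow> card j = d \<Longrightarrow> i \<noteq> j \<Longrightarrow> a i j = 0) \<Longrightarrow>
      ennvariance (quadratic_form d a) \<le> ennreal (p * F * ((1 + K * r) ^ d - 1))"
    and ennvariance_zero_diagonal_le: "(\<And>i. i \<subseteq> N \<Longrightarrow> card i = d \<Longrightarrow> a i i = 0) \<Longrightarrow>
      ennvariance (quadratic_form d a) \<le> ennreal (p * F * ((1 + 2 * K * r) ^ d * (16 * r)))"
    and ennvariance_arbitrary_le: "2 * K * (real d)\<^sup>2 \<le> real (card N) \<Longrightarrow>
      ennvariance (quadratic_form d a) \<le> ennreal (p * F * (64 * K * (real d)\<^sup>2 / real (card N)))"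
proof -
  define P where "P = {(i, j). (i \<subseteq> N \<and> card i = d) \<and> (j \<subseteq> N \<and> card j = d) \<and> i \<noteq> j}"
  define FD FO where "FD = (\<Sum>i | i \<subseteq> N \<and> card i = d. (a i i)\<^sup>2)" and "FO = (\<Sum>(i, j)\<in>P. (a i j)\<^sup>2)"
  have F: "F = FD + FO"
    unfolding F_def FD_def FO_def P_def by (rule sum_subsets_split_diagonal)
  have FD: "0 \<le> FD" and FO: "0 \<le> FO"
    by (auto simp: FD_def FO_def intro!: sum_nonneg)
  have p: "0 \<le> p" and r: "0 \<le> r" by (auto simp: p_def r_def)
  note K = K_ge_1
  note E = ennvariance_quadratic_form_le[OF d, of a]
  define ED EO where "ED = expectation (\<lambda>\<omega>. (diag_form d a \<omega>)\<^sup>2)"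
    and "EO = expectation (\<lambda>\<omega>. (off_diag_form d a \<omega>)\<^sup>2)"
  have ED: "ED \<le> p * ((1 + K * r) ^ d - 1) * FD"
    using expectation_diag_form_square_le[of d a] d by (simp add: ED_def p_def r_def FD_def)
  have EO: "EO \<le> p * (16 * r * (1 + 2 * K * r) ^ d) * FO"
    using expectation_off_diag_form_square_le[OF d, of a] by (simp add: EO_def p_def r_def FO_def P_def)
  show "ennvariance (quadratic_form d a) \<le> ennreal (p * F * ((1 + K * r) ^ d - 1))"
    if a0: "\<And>i j. i \<subseteq> N \<Longrightarrow> card i = d \<Longrightarrow> j \<subseteq> N \<Longrightarrow> card j = d \<Longrightarrow> i \<noteq> j \<Longrightarrow> a i j = 0"
  proof -
    have "off_diag_form d a \<omega> = 0" for \<omega>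
      unfolding off_diag_form_def using a0 by (intro sum.neutral) auto
    moreover have "FO = 0"
      unfolding FO_def P_def using a0 by (intro sum.neutral) auto
    ultimately show ?thesis
      using E(1) ED by (auto simp: ED_def F mult_ac intro: order_trans ennreal_leI)
  qed
  show "ennvariance (quadratic_form d a) \<le> ennreal (p * F * ((1 + 2 * K * r) ^ d * (16 * r)))"
    if a0: "\<And>i. i \<subseteq> N \<Longrightarrow> card i = d \<Longrightarrow> a i i = 0"
  proof -
    have "diag_form d a \<omega> = 0" for \<omega>
      unfolding diag_form_def using a0 by (intro sum.neutral) auto
    moreover have "FD = 0"
      unfolding FD_def using a0 by (intro sum.neutral) auto
    ultimately show ?thesis
      using E(1) EO by (auto simp: EO_def F mult_ac intro: order_trans ennreal_leI)
  qed
  show "ennvariance (quadratic_form d a) \<le> ennreal (p * F * (64 * K * (real d)\<^sup>2 / real (card N)))"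
    if small: "2 * K * (real d)\<^sup>2 \<le> real (card N)"
  proof -
    have n: "0 < real (card N)" using d by simp
    \<comment> \<open>This is K d^2 / n, which the smallness assumption bounds by 1/2.\<close>
    define z where "z = real d * (K * r)"
    have z: "0 \<le> z" "2 * z \<le> 1" "z = K * (real d)\<^sup>2 / real (card N)"
      using K r small n by (auto simp: z_def r_def field_simps power2_eq_square)
    have rz: "r \<le> z"
      using K d r mult_mono[of 1 "real d" r "K * r"] mult_right_mono[of 1 K r] by (simp add: z_def)
    \<comment> \<open>Since \<open>z \<le> 1\<close>, the right-hand side is at most z + z^2, hence
      at most 2 z. The constant 16 is what the target 64 leaves after the factor 4.\<close>
    have "(1 + K * r) ^ d - 1 \<le> exp z - 1"
      using one_plus_power_le_exp[of "K * r" d] K r by (simp add: z_def)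
    also have "\<dots> \<le> 16 * z"
      using exp_bound[of z] z mult_left_mono[of z 1 z] by (simp add: power2_eq_square)
    finally have D: "(1 + K * r) ^ d - 1 \<le> 16 * z" .
    \<comment> \<open>From 2 z <= 1 the power is at most e, hence at most 3. With
      \<open>r \<le> z\<close> this gives 48 z, and 4/3 times 48 is again 64.\<close>
    have "(1 + 2 * K * r) ^ d \<le> exp (2 * z)"
      using one_plus_power_le_exp[of "2 * K * r" d] K r by (simp add: z_def mult_ac)
    also have "\<dots> \<le> exp 1" using z by simp
    also have "\<dots> \<le> 3" by (rule exp_le)
    finally have "16 * r * (1 + 2 * K * r) ^ d \<le> 16 * z * 3"
      using rz r K by (intro mult_mono) auto
    then have O: "EO \<le> p * (48 * z) * FO"
      using p FO by (intro order_trans[OF EO] mult_right_mono mult_left_mono) auto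
    have "ED \<le> p * (16 * z) * FD"
      using D p FD by (intro order_trans[OF ED] mult_right_mono mult_left_mono) auto
    with O have "4 * ED + 4 / 3 * EO \<le> p * F * (64 * z)"
      by (simp add: F algebra_simps)
    then show ?thesis
      using E by (auto simp: ED_def EO_def z(3) mult_ac intro!: order_trans[OF E(1)] ennreal_leI)
  qed
qed

end

section \<open>Transfer to random vectors and matrices\<close>

lemma inner_matrix_vector_mult:
  fixes A :: "real ^ 'p ^ 'p"
  shows "y \<bullet> (A *v y) = (\<Sum>k\<in>UNIV. \<Sum>l\<in>UNIV. A $ k $ l * (y $ k * y $ l))"
  by (simp add: inner_vec_def matrix_vector_mult_def sum_distrib_left mult_ac)

text \<open>The trace in the bounds is the squared Frobenius norm, which is the sum of squares that
  the Schur test produces.\<close>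

lemma trace_mult_transpose:
  fixes A :: "real ^ 'p ^ 'p"
  shows "trace (A ** transpose A) = (\<Sum>k\<in>UNIV. \<Sum>l\<in>UNIV. (A $ k $ l)\<^sup>2)"
  by (simp add: trace_def matrix_matrix_mult_def transpose_def power2_eq_square)

theorem theorem2p2:
  fixes M :: "'a measure" and d n :: nat
    and X :: "nat \<Rightarrow> 'a \<Rightarrow> real" and x :: "'a \<Rightarrow> real ^ 'p"
    and A :: "real ^ 'p ^ 'p" and p :: nat and K V :: ennreal
  assumes "prob_space M"
    and "n \<ge> 1" and "n \<ge> 16 * d"
    and "p = n choose d"
    and "prob_space.random_tensor_model M d n X x"
    and "K = Max ((\<lambda>\<alpha>. \<integral>\<^sup>+ \<omega>. ennreal (X \<alpha> \<omega> ^ 4) \<partial>M) ` {1..n})"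
    and "V = prob_space.ennvariance M (\<lambda>\<omega>. x \<omega> \<bullet> (A *v x \<omega>))"
  shows "((\<forall>i j. i \<noteq> j \<longrightarrow> A $ i $ j = 0) \<longrightarrow>
            V \<le> ennreal (real p * trace (A ** transpose A)) *
                 ((1 + K * of_nat d / of_nat n) ^ d - 1)) \<and>
         ((\<forall>i. A $ i $ i = 0) \<longrightarrow>
            V \<le> ennreal (real p * trace (A ** transpose A)) *
                 ((1 + 2 * K * of_nat d / of_nat n) ^ d * (16 * of_nat d / of_nat n) *
                  of_nat (min d 8))) \<and>
         (2 * K * of_nat d ^ 2 \<le> of_nat n \<longrightarrow>
            V \<le> ennreal (real p * trace (A ** transpose A)) *
                 (64 * K * of_nat d ^ 2 / of_nat n))"
proof -
  interpret prob_space M by fact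
  define S where "S = {i. i \<subseteq> {1..n} \<and> card i = d}"
  obtain e where e: "bij_betw e (UNIV :: 'p set) S"
    and xe: "\<And>\<omega> k. \<omega> \<in> space M \<Longrightarrow> x \<omega> $ k = (\<Prod>\<alpha>\<in>e k. X \<alpha> \<omega>)"
    and dn: "d \<le> n" and indep: "indep_vars (\<lambda>_. borel) X {1..n}"
    and X: "\<And>\<alpha>. \<alpha> \<in> {1..n} \<Longrightarrow> integrable M (X \<alpha>) \<and> expectation (X \<alpha>) = 0 \<and> variance (X \<alpha>) = 1"
    using assms(5) unfolding random_tensor_model_def S_def by blast
  define T where "T = trace (A ** transpose A)"
  have T: "T = (\<Sum>k\<in>UNIV. \<Sum>l\<in>UNIV. (A $ k $ l)\<^sup>2)"
    unfolding T_def by (rule trace_mult_transpose)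
  have T_nonneg: "0 \<le> T" unfolding T by (intro sum_nonneg) auto
  have p: "0 < real p" using dn assms(4) by simp
  \<comment> \<open>For \<open>d = 0\<close> every entry of the vector is an empty product, and for
    \<open>T = 0\<close> the matrix is zero; the form is constant in both cases. Afterwards no
    factor 0 can meet an infinite \<open>K\<close> on the right-hand side.\<close>
  consider "V = 0" | "1 \<le> d" "0 < T"
  proof (cases "d = 0 \<or> T = 0")
    case True
    have "V = 0"
    proof (cases "d = 0")
      case True
      have "e k = {}" for k
      proof -
        have "e k \<in> S" using e by (auto dest: bij_betwE)
        then show ?thesis using True finite_subset[of "e k" "{1..n}"] by (auto simp: S_def)
      qed
      then have "V = ennvariance (\<lambda>_. \<Sum>k\<in>UNIV. \<Sum>l\<in>UNIV. A $ k $ l)"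
        unfolding assms(7) by (intro ennvariance_cong) (simp add: inner_matrix_vector_mult xe)
      then show ?thesis by (simp add: ennvariance_const)
    next
      case False
      then have "A $ k $ l = 0" for k l
        using True unfolding T by (simp add: sum_nonneg sum_nonneg_eq_0_iff)
      then show ?thesis
        unfolding assms(7) inner_matrix_vector_mult by (simp add: ennvariance_const)
    qed
    then show ?thesis using that by blast
  next
    case False
    then show ?thesis using that T_nonneg by auto
  qed
  then show ?thesis
  proof cases
    case 1
    then show ?thesis by simp
  next
    case 2
    show ?thesis
    \<comment> \<open>If \<open>K\<close> is infinite, the first two right-hand sides are infinite,
      because \<open>p\<close>, \<open>T\<close> and \<open>d\<close> are positive, and the
      hypothesis of the third claim fails.\<close>
    proof (cases "K = top")
      case True
      have "ennreal (real p * T) \<noteq> 0" using p 2 by simp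
      moreover have "K * of_nat d / of_nat n = top" "2 * K * of_nat d / of_nat n = top"
        "2 * K * of_nat d ^ 2 = top"
        using True 2 by (simp_all add: ennreal_mult_top ennreal_top_mult ennreal_top_divide)
      moreover have "16 * of_nat d / of_nat n * of_nat (min d 8) \<noteq> (0 :: ennreal)"
        using 2 by (auto simp: ennreal_divide_eq_0_iff)
      ultimately show ?thesis
        using 2 unfolding T_def[symmetric]
        by (auto simp: ennreal_mult_top ennreal_top_mult mult.assoc top_power_ennreal top_unique)
    next
      case False
      define \<kappa> where "\<kappa> = enn2real K"
      have K: "K = ennreal \<kappa>" and \<kappa>: "0 \<le> \<kappa>"
        using False by (auto simp: \<kappa>_def less_top)
      have fourth: "(\<integral>\<^sup>+ \<omega>. ennreal (X \<alpha> \<omega> ^ 4) \<partial>M) \<le> ennreal \<kappa>" if "\<alpha> \<in> {1..n}" for \<alpha>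
        unfolding K[symmetric] assms(6) using that by (intro Max_ge) auto
      have meas: "X \<alpha> \<in> borel_measurable M" if "\<alpha> \<in> {1..n}" for \<alpha>
        using X[OF that] by blast
      have int: "integrable M (\<lambda>\<omega>. X \<alpha> \<omega> ^ 4)" if "\<alpha> \<in> {1..n}" for \<alpha>
        using meas[OF that] fourth[OF that]
        by (intro integrableI_nonneg) (auto intro: le_less_trans)
      interpret fourth_moment_sample M X "{1..n}" \<kappa>
      proof
        fix \<alpha> assume \<alpha>: "\<alpha> \<in> {1..n}"
        show "expectation (X \<alpha>) = 0" "expectation (\<lambda>\<omega>. X \<alpha> \<omega> ^ 2) = 1"
          using X[OF \<alpha>] by auto
        show "integrable M (\<lambda>\<omega>. X \<alpha> \<omega> ^ 4)" by (rule int[OF \<alpha>])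
        have "ennreal (expectation (\<lambda>\<omega>. X \<alpha> \<omega> ^ 4)) \<le> ennreal \<kappa>"
          using fourth[OF \<alpha>] by (subst (asm) nn_integral_eq_integral[OF int[OF \<alpha>]]) auto
        then show "expectation (\<lambda>\<omega>. X \<alpha> \<omega> ^ 4) \<le> \<kappa>" using \<kappa> by simp
      qed (use assms(2) indep in auto)
      \<comment> \<open>The matrix is reindexed by sets through the inverse of the bijection
        \<open>e\<close>.\<close>
      define a where "a i j = A $ inv_into UNIV e i $ inv_into UNIV e j" for i j
      have a_e: "a (e k) (e l) = A $ k $ l" for k l
        using e by (simp add: a_def bij_betw_def inv_into_f_f)
      have sum_e: "(\<Sum>i\<in>S. \<Sum>j\<in>S. f i j) = (\<Sum>k\<in>UNIV. \<Sum>l\<in>UNIV. f (e k) (e l))"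
        for f :: "nat set \<Rightarrow> nat set \<Rightarrow> real"
        by (simp only: sum.reindex_bij_betw[OF e, symmetric])
      have V: "V = ennvariance (quadratic_form d a)"
        unfolding assms(7)
      proof (rule ennvariance_cong)
        fix \<omega> assume "\<omega> \<in> space M"
        then show "x \<omega> \<bullet> (A *v x \<omega>) = quadratic_form d a \<omega>"
          unfolding quadratic_form_def S_def[symmetric] sum_e inner_matrix_vector_mult
          by (simp add: a_e monomial_def xe)
      qed
      have F: "(\<Sum>i | i \<subseteq> {1..n} \<and> card i = d. \<Sum>j | j \<subseteq> {1..n} \<and> card j = d. (a i j)\<^sup>2) = T"
        unfolding S_def[symmetric] sum_e T by (simp add: a_e)
      have d: "1 \<le> d" "16 * d \<le> card {1..n}" using 2 assms(3) by auto
      have n: "0 < real n" using assms(2) by simp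
      have \<kappa>1: "1 \<le> \<kappa>" by (rule K_ge_1)
      have frac: "K * of_nat d / of_nat n = ennreal (\<kappa> * real d / real n)"
        "2 * K * of_nat d / of_nat n = ennreal (2 * \<kappa> * real d / real n)"
        "16 * of_nat d / of_nat n = ennreal (16 * real d / real n)"
        "64 * K * of_nat d ^ 2 / of_nat n = ennreal (64 * \<kappa> * (real d)\<^sup>2 / real n)"
        "2 * K * of_nat d ^ 2 = ennreal (2 * \<kappa> * (real d)\<^sup>2)"
        unfolding K using n \<kappa>
        by (simp_all add: ennreal_of_nat_eq_real_of_nat ennreal_mult ennreal_power
            flip: ennreal_numeral divide_ennreal)
      have e_surj: "\<exists>k. i = e k" if "i \<subseteq> {1..n}" "card i = d" for i
        using bij_betw_imp_surj_on[OF e] that unfolding S_def by blast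
      show ?thesis
        unfolding T_def[symmetric]
      proof (intro conjI impI)
        assume "\<forall>i j. i \<noteq> j \<longrightarrow> A $ i $ j = 0"
        then have "a i j = 0"
          if "i \<subseteq> {1..n}" "card i = d" "j \<subseteq> {1..n}" "card j = d" "i \<noteq> j" for i j
          using a_e e_surj[OF that(1,2)] e_surj[OF that(3,4)] that(5) by metis
        then have "V \<le> ennreal (real p * T * ((1 + \<kappa> * (real d / real n)) ^ d - 1))"
          unfolding V using ennvariance_diagonal_le[OF d, of a] F by (simp add: assms(4))
        \<comment> \<open>Subtraction on \<open>ennreal\<close> is truncated, but the power is at
          least 1, so it agrees with real subtraction here.\<close>
        also have "\<dots> = ennreal (real p * T) * ((1 + K * of_nat d / of_nat n) ^ d - 1)"
          unfolding frac using p T_nonneg \<kappa>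
          by (simp add: ennreal_mult ennreal_minus ennreal_power flip: ennreal_1 ennreal_plus)
        finally show "V \<le> ennreal (real p * T) * ((1 + K * of_nat d / of_nat n) ^ d - 1)" .
      next
        assume "\<forall>i. A $ i $ i = 0"
        then have "a i i = 0" if "i \<subseteq> {1..n}" "card i = d" for i
          using a_e e_surj[OF that] by auto
        then have "V \<le> ennreal (real p * T * ((1 + 2 * \<kappa> * real d / real n) ^ d * (16 * real d / real n)))"
          unfolding V using ennvariance_zero_diagonal_le[OF d, of a] F by (simp add: assms(4))
        \<comment> \<open>The explicit factor 1 is the place where \<open>min d 8\<close> enters by
          monotonicity, being at least 1 for \<open>1 \<le> d\<close>.\<close>
        also have "\<dots> = ennreal (real p * T) *
            ((1 + 2 * K * of_nat d / of_nat n) ^ d * (16 * of_nat d / of_nat n) * 1)"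
          unfolding frac using p T_nonneg \<kappa>
          by (simp add: ennreal_mult ennreal_plus ennreal_power[symmetric]
              del: times_divide_eq_right times_divide_eq_left)
        also have "\<dots> \<le> ennreal (real p * T) *
            ((1 + 2 * K * of_nat d / of_nat n) ^ d * (16 * of_nat d / of_nat n) * of_nat (min d 8))"
          using d(1) by (intro mult_left_mono) (auto simp: min_def)
        finally show "V \<le> ennreal (real p * T) *
            ((1 + 2 * K * of_nat d / of_nat n) ^ d * (16 * of_nat d / of_nat n) * of_nat (min d 8))" .
      next
        assume "2 * K * of_nat d ^ 2 \<le> of_nat n"
        then have "2 * \<kappa> * (real d)\<^sup>2 \<le> real (card {1..n})"
          unfolding frac by (simp add: ennreal_of_nat_eq_real_of_nat)
        then have "V \<le> ennreal (real p * T * (64 * \<kappa> * (real d)\<^sup>2 / real n))"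
          unfolding V using ennvariance_arbitrary_le[OF d, of a] F by (simp add: assms(4))
        also have "\<dots> = ennreal (real p * T) * (64 * K * of_nat d ^ 2 / of_nat n)"
          unfolding frac using p T_nonneg \<kappa> by (simp add: ennreal_mult del: times_divide_eq_right times_divide_eq_left)
        finally show "V \<le> ennreal (real p * T) * (64 * K * of_nat d ^ 2 / of_nat n)" .
      qed
    qed
  qed
qed

end
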